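(* Let $\mu$ be a function on Borel subsets of $\mathbf{S}^n$ such that (i) $\mu$ is nonnegative and countably additive; (ii) $\mu(\mathbf{S}^n)=\sigma(\mathbf{S}^n)$; (iii) $\mu(\mathbf{S}^n\setminus\omega)>\sigma(\omega^* )$ for every spherically convex $\omega\subset\mathbf{S}^n$, $\omega\ne\mathbf{S}^n$. Let $(\tilde h,\tilde\rho)\in\mathcal{A}$ be the (unique up to rescaling) pair minimizing $\mathcal{Q}$ over $\mathcal{A}$. Then there exists $\tilde\gamma\in\Gamma(\mu,\sigma)$ with $\mathcal{C}[\tilde\gamma]=\sup_{\gamma\in\Gamma(\mu,\sigma)}\mathcal{C}[\gamma]$, and $$\mathcal{Q}[\tilde h,\tilde\rho]=\mathcal{C}[\tilde\gamma].$$
   Context: $\mathbf{S}^n$ is the unit sphere in $\mathbb{R}^{n+1}$, $n\ge1$, centered at the origin; $\sigma$ is the standard Lebesgue measure on $\mathbf{S}^n$; $\omega^*=\{y\in\mathbf{S}^n:\langle x,y\rangle\le0\ \forall x\in\omega\}$. $\mathcal{A}=\{(h,\rho)\in C(\mathbf{S}^n)\times C(\mathbf{S}^n): h>0,\rho>0,\ \log h(N)-\log\rho(x)\ge\log\langle x,N\rangle$ for all $(x,N)$ with $\langle x,N\rangle>0\}$ and $\mathcal{Q}[h,\rho]=\int_{\mathbf{S}^n}\log h(N)\,d\sigma(N)-\int_{\mathbf{S}^n}\log\rho(x)\,d\mu(x)$. The cost is $c(x,N)=\log\langle x,N\rangle$ if $\langle x,N\rangle>0$ and $-\infty$ otherwise.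 $\Gamma(\mu,\sigma)$ is the set of Borel measures $\gamma$ on $\mathbf{S}^n\times\mathbf{S}^n$ with $\gamma[U\times\mathbf{S}^n]=\mu[U]$ and $\gamma[\mathbf{S}^n\times U]=\sigma[U]$ for all Borel $U\subset\mathbf{S}^n$, and $\mathcal{C}[\gamma]=\int_{\mathbf{S}^n}\int_{\mathbf{S}^n}c(x,N)\,d\gamma(x,N)$. *)

theory Defs
  imports "HOL-Probability.Probability"
begin

text \<open>The unit sphere S^n in R^(n+1) is modelled as sphere 0 1 in a Euclidean space 'a
  with DIM('a) = n+1.\<close>

abbreviation Sph :: "'a::euclidean_space set" where
  "Sph \<equiv> sphere 0 1"

definition sph_borel :: "'a::euclidean_space measure" where
  "sph_borel = restrict_space borel Sph"

text \<open>Standard (surface) Lebesgue measure on the sphere, via the cone formula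
  sigma(U) = (n+1) * vol{ y : 0 < |y| <= 1, y/|y| in U }.\<close>
definition sph_sigma :: "'a::euclidean_space measure" where
  "sph_sigma = measure_of Sph (sets sph_borel)
     (\<lambda>U. ennreal (real DIM('a)) *
          emeasure lborel {y. 0 < norm y \<and> norm y \<le> 1 \<and> sgn y \<in> U})"

definition polar_set :: "'a::euclidean_space set \<Rightarrow> 'a set" where
  "polar_set \<omega> = {y \<in> Sph. \<forall>x\<in>\<omega>. inner x y \<le> 0}"

definition sph_convex :: "'a::euclidean_space set \<Rightarrow> bool" where
  "sph_convex \<omega> \<longleftrightarrow> \<omega> \<subseteq> Sph \<and> convex {t *\<^sub>R x | t x. 0 \<le> t \<and> x \<in> \<omega>}"

definition admissible :: "('a::euclidean_space \<Rightarrow> real) \<Rightarrow> ('a \<Rightarrow> real) \<Rightarrow> bool" where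
  "admissible h \<rho> \<longleftrightarrow>
     continuous_on Sph h \<and> continuous_on Sph \<rho> \<and>
     (\<forall>x\<in>Sph. h x > 0) \<and> (\<forall>x\<in>Sph. \<rho> x > 0) \<and>
     (\<forall>x\<in>Sph. \<forall>N\<in>Sph. inner x N > 0 \<longrightarrow> ln (h N) - ln (\<rho> x) \<ge> ln (inner x N))"

definition Qfun :: "'a::euclidean_space measure \<Rightarrow> ('a \<Rightarrow> real) \<Rightarrow> ('a \<Rightarrow> real) \<Rightarrow> real" where
  "Qfun \<mu> h \<rho> = (\<integral>N. ln (h N) \<partial>sph_sigma) - (\<integral>x. ln (\<rho> x) \<partial>\<mu>)"

definition neg_cost :: "'a::euclidean_space \<times> 'a \<Rightarrow> ennreal" where
  "neg_cost p = (if inner (fst p) (snd p) > 0 then ennreal (- ln (inner (fst p) (snd p))) else \<infinity>)"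

text \<open>Total cost C[gamma] = integral of c (a nonpositive extended-real function).\<close>
definition Cost :: "('a::euclidean_space \<times> 'a) measure \<Rightarrow> ereal" where
  "Cost \<gamma> = - enn2ereal (\<integral>\<^sup>+ p. neg_cost p \<partial>\<gamma>)"

definition Plans :: "'a::euclidean_space measure \<Rightarrow> 'a measure \<Rightarrow> ('a \<times> 'a) measure set" where
  "Plans \<mu> \<nu> = {\<gamma>. sets \<gamma> = sets (sph_borel \<Otimes>\<^sub>M sph_borel) \<and>
     (\<forall>U\<in>sets sph_borel. emeasure \<gamma> (U \<times> Sph) = emeasure \<mu> U \<and>
                          emeasure \<gamma> (Sph \<times> U) = emeasure \<nu> U)}"

end

theory Submission
  imports Defs
begin

text \<open>
  Weak duality: integrating the admissibility inequality against a plan bounds every cost by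
  \<open>Qfun\<close>. For equality replace \<open>h\<close> by the support function of the radial graph
  \<open>{\<rho> x *\<^sub>R x}\<close>, which can only decrease \<open>Qfun\<close>. For almost every \<open>N\<close> the supremum defining it is
  attained at a single contact point \<open>T N\<close>. Perturbing \<open>\<rho>\<close> to \<open>\<rho> * exp (t * f)\<close> changes the logarithm
  of the support function at \<open>N\<close> to first order by \<open>t * f (T N)\<close>, so minimality says that \<open>T\<close> pushes
  \<open>sph_sigma\<close> forward to \<open>\<mu>\<close>. The plan concentrated on the graph of \<open>T\<close> lives where the admissibility
  inequality is an equality, hence its cost is the minimum of \<open>Qfun\<close>.

  Uniqueness of the contact point amounts to almost everywhere differentiability of a convex function.
  It is obtained without Rademacher's theorem: on each line the set of exceptional points is countable,
  and a Borel set meeting all lines of one direction in countable sets is null by Tonelli.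
\<close>

subsection \<open>Almost everywhere uniqueness of maximizers of linear functionals\<close>

text \<open>For compact nonempty \<open>K\<close>, the convex hull of this set is the
  subdifferential at \<open>y\<close> of the support function of \<open>K\<close>.\<close>

definition maximizers :: "'a::euclidean_space set \<Rightarrow> 'a \<Rightarrow> 'a set" where
  "maximizers K y = {z \<in> K. \<forall>w\<in>K. inner w y \<le> inner z y}"

text \<open>By translation invariance the measure of \<open>A\<close> is its average over the shifts
  by \<open>t *\<^sub>R b\<close> with \<open>t\<close> in \<open>{0..1}\<close>. Once the two
  integrals are exchanged, the inner one runs over a countable set of \<open>t\<close>. This slices
  along \<open>b\<close> without any change of coordinates.\<close>

lemma emeasure_lborel_zero_if_countable_on_lines:
  fixes A :: "'a::euclidean_space set"
  assumes A[measurable]: "A \<in> sets borel" and lines: "\<And>y. countable {t::real. y + t *\<^sub>R b \<in> A}"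
  shows "emeasure lborel A = 0"
proof -
  have shift: "(\<integral>\<^sup>+ y. indicator A (y + t *\<^sub>R b) \<partial>lborel) = emeasure lborel A" for t
  proof -
    have "emeasure lborel A = (\<integral>\<^sup>+ y. indicator A y \<partial>distr lborel borel ((+) (t *\<^sub>R b)))"
      by (simp add: lborel_distr_plus)
    also have "\<dots> = (\<integral>\<^sup>+ y. indicator A (t *\<^sub>R b + y) \<partial>lborel)"
      by (rule nn_integral_distr) auto
    finally show ?thesis by (simp add: add.commute)
  qed
  have "emeasure lborel A = (\<integral>\<^sup>+ t. emeasure lborel A * indicator {0..1} t \<partial>(lborel::real measure))"
    by (subst nn_integral_cmult_indicator) auto
  also have "\<dots> = (\<integral>\<^sup>+ t. \<integral>\<^sup>+ y. indicator A (y + t *\<^sub>R b) * indicator {0..1::real} t \<partial>lborel \<partial>lborel)"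
    by (subst nn_integral_multc) (auto simp: shift)
  also have "\<dots> = (\<integral>\<^sup>+ y. \<integral>\<^sup>+ t. indicator A (y + t *\<^sub>R b) * indicator {0..1::real} t \<partial>lborel \<partial>lborel)"
    by (rule lborel_pair.Fubini'[symmetric]) measurable
  also have "\<dots> = (\<integral>\<^sup>+ y. 0 \<partial>(lborel::'a measure))"
  proof (rule nn_integral_cong)
    fix y :: 'a
    have "AE t in lborel. t \<notin> {t::real. y + t *\<^sub>R b \<in> A}"
      using countable_imp_null_set_lborel[OF lines[of y]] by (rule AE_not_in)
    then have "(\<integral>\<^sup>+ t. indicator A (y + t *\<^sub>R b) * indicator {0..1::real} t \<partial>lborel) = (\<integral>\<^sup>+ t. 0 \<partial>(lborel::real measure))"
      by (intro nn_integral_cong_AE) (auto simp: indicator_def)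
    then show "(\<integral>\<^sup>+ t. indicator A (y + t *\<^sub>R b) * indicator {0..1::real} t \<partial>lborel) = 0" by simp
  qed
  finally show ?thesis by simp
qed

lemma maximizers_exist:
  assumes "compact K" "K \<noteq> {}"
  shows "\<exists>z. z \<in> maximizers K y"
proof -
  have "continuous_on K (\<lambda>z. inner z y)" by (intro continuous_intros)
  from continuous_attains_sup[OF assms this] show ?thesis by (auto simp: maximizers_def)
qed

text \<open>The optimality condition is closed in the pair of maximizer and direction, and
  projecting along the compact factor \<open>K\<close> keeps it closed. This yields the Borel
  measurability of \<open>maximizer\<close>.\<close>

lemma closed_maximizers_meets:
  assumes "compact K" "closed C"
  shows "closed {y. \<exists>z\<in>C. z \<in> maximizers K y}"
proof -
  have "closed ({p. fst p \<in> C} \<inter> {p. \<forall>w\<in>K. inner w (snd p) \<le> inner (fst p) (snd p)})"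
    unfolding Ball_def using assms
    by (intro closed_Int closed_Collect_all closed_Collect_imp closed_Collect_le continuous_intros
          closed_vimage[of C fst, unfolded vimage_def]) auto
  from closed_compact_projection[OF assms(1) this] show ?thesis
    by (rule back_subst[of closed]) (auto simp: maximizers_def)
qed

text \<open>The maximizers of \<open>inner z (y + t *\<^sub>R b)\<close> have a component along \<open>b\<close> that is monotone in \<open>t\<close>,
  so on each line only countably many points can have a jump.\<close>
lemma countable_nonunique_on_line:
  "countable {t::real. \<exists>u\<in>maximizers K (y + t *\<^sub>R b). \<exists>v\<in>maximizers K (y + t *\<^sub>R b). inner v b < inner u b}"
    (is "countable ?S")
proof -
  \<comment> \<open>Each exceptional \<open>t\<close> is labelled by a rational inside its gap;
    distinct points will get distinct labels.\<close>
  have "\<forall>t\<in>?S. \<exists>q::real. q \<in> \<rat> \<and> (\<exists>u\<in>maximizers K (y + t *\<^sub>R b). \<exists>v\<in>maximizers K (y + t *\<^sub>R b).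
      inner v b < q \<and> q < inner u b)"
  proof
    fix t assume "t \<in> ?S"
    then obtain u v where uv: "u \<in> maximizers K (y + t *\<^sub>R b)" "v \<in> maximizers K (y + t *\<^sub>R b)" "inner v b < inner u b"
      by blast
    from Rats_dense_in_real[OF uv(3)] uv(1,2) show "\<exists>q::real. q \<in> \<rat> \<and> (\<exists>u\<in>maximizers K (y + t *\<^sub>R b).
      \<exists>v\<in>maximizers K (y + t *\<^sub>R b). inner v b < q \<and> q < inner u b)" by blast
  qed
  from bchoice[OF this] obtain q :: "real \<Rightarrow> real" where "\<forall>t\<in>?S. q t \<in> \<rat> \<and> (\<exists>u\<in>maximizers K (y + t *\<^sub>R b).
      \<exists>v\<in>maximizers K (y + t *\<^sub>R b). inner v b < q t \<and> q t < inner u b)" ..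
  then have q: "q t \<in> \<rat> \<and> (\<exists>u\<in>maximizers K (y + t *\<^sub>R b).
      \<exists>v\<in>maximizers K (y + t *\<^sub>R b). inner v b < q t \<and> q t < inner u b)" if "t \<in> ?S" for t
    using that by (rule bspec)
  have mono: "q s < q t" if st: "s \<in> ?S" "t \<in> ?S" "s < t" for s t
  proof -
    obtain u where u: "u \<in> maximizers K (y + s *\<^sub>R b)" "q s < inner u b" using q[OF st(1)] by blast
    obtain v where v: "v \<in> maximizers K (y + t *\<^sub>R b)" "inner v b < q t" using q[OF st(2)] by blast
    \<comment> \<open>Adding the optimality of \<open>u\<close> at parameter \<open>s\<close> to
      that of \<open>v\<close> at \<open>t\<close> cancels everything but the components along
      \<open>b\<close>, so the gap at \<open>s\<close> lies entirely below the gap at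
      \<open>t\<close>.\<close>
    have "inner v (y + s *\<^sub>R b) \<le> inner u (y + s *\<^sub>R b)" "inner u (y + t *\<^sub>R b) \<le> inner v (y + t *\<^sub>R b)"
      using u v by (auto simp: maximizers_def)
    then have "(t - s) * inner u b \<le> (t - s) * inner v b"
      by (simp add: inner_right_distrib algebra_simps)
    with \<open>s < t\<close> have "inner u b \<le> inner v b" by simp
    with u v show ?thesis by simp
  qed
  have "inj_on q ?S"
  proof (rule inj_onI)
    fix s t assume "s \<in> ?S" "t \<in> ?S" "q s = q t"
    then show "s = t" using mono[of s t] mono[of t s] by (cases s t rule: linorder_cases) auto
  qed
  moreover have "countable (q ` ?S)"
    by (rule countable_subset[OF _ countable_rat]) (use q in auto)
  ultimately show ?thesis by (rule countable_image_inj_on[rotated])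
qed

text \<open>For compact nonempty \<open>K\<close>, these are the points where the support function
  of \<open>K\<close> fails to be differentiable.\<close>

definition nonunique :: "'a::euclidean_space set \<Rightarrow> 'a set" where
  "nonunique K = {y. \<exists>u\<in>maximizers K y. \<exists>v\<in>maximizers K y. u \<noteq> v}"

text \<open>Two distinct maximizers differ in some coordinate \<open>b\<close>, and for a fixed
  \<open>b\<close> such points are countable on every line in direction \<open>b\<close>. Only
  finitely many \<open>b\<close> occur.\<close>

lemma nonunique_null:
  fixes K :: "'a::euclidean_space set"
  assumes K: "compact K"
  shows "nonunique K \<in> null_sets lborel"
proof -
  define A where "A b = {y. \<exists>u\<in>maximizers K y. \<exists>v\<in>maximizers K y. inner v b < inner u b}" for b
  have A: "A b \<in> null_sets lborel" for b
  proof -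
    \<comment> \<open>Demanding a gap of at least \<open>inverse (real (Suc n))\<close> turns the
      strict inequality into a closed condition, so \<open>A b\<close> becomes a countable union of
      closed sets and is Borel.\<close>
    define T :: "nat \<Rightarrow> (('a \<times> 'a) \<times> 'a) set" where
      "T n = {p. inner (snd (fst p)) b + inverse (real (Suc n)) \<le> inner (fst (fst p)) b} \<inter>
        {p. \<forall>w\<in>K. inner w (snd p) \<le> inner (fst (fst p)) (snd p)} \<inter>
        {p. \<forall>w\<in>K. inner w (snd p) \<le> inner (snd (fst p)) (snd p)}" for n
    have cl: "closed (T n)" for n
      unfolding T_def Ball_def
      by (intro closed_Int closed_Collect_all closed_Collect_imp closed_Collect_le continuous_intros) auto
    have "A b = (\<Union>n. {y. \<exists>p. p \<in> K \<times> K \<and> (p, y) \<in> T n})"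
    proof (intro equalityI subsetI)
      fix y assume "y \<in> A b"
      then obtain u v where uv: "u \<in> maximizers K y" "v \<in> maximizers K y" "inner v b < inner u b"
        by (auto simp: A_def)
      obtain n where "inverse (real (Suc n)) < inner u b - inner v b"
        using reals_Archimedean[of "inner u b - inner v b"] uv by auto
      then have "(u, v) \<in> K \<times> K \<and> ((u, v), y) \<in> T n"
        using uv by (auto simp: T_def maximizers_def)
      then show "y \<in> (\<Union>n. {y. \<exists>p. p \<in> K \<times> K \<and> (p, y) \<in> T n})" by blast
    next
      fix y assume "y \<in> (\<Union>n. {y. \<exists>p. p \<in> K \<times> K \<and> (p, y) \<in> T n})"
      then obtain n u v where *: "u \<in> K" "v \<in> K" "((u, v), y) \<in> T n" by auto
      have "0 < inverse (real (Suc n))" by simp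
      with * have "inner v b < inner u b" by (auto simp: T_def simp del: inverse_positive_iff_positive)
      with * show "y \<in> A b" by (auto simp: A_def T_def maximizers_def)
    qed
    also have "\<dots> \<in> sets borel"
      using closed_compact_projection[OF compact_Times[OF K K] cl] by (intro sets.countable_UN) auto
    finally have "A b \<in> sets borel" .
    moreover from this have "emeasure lborel (A b) = 0"
      by (rule emeasure_lborel_zero_if_countable_on_lines[where b = b])
        (simp add: A_def countable_nonunique_on_line)
    ultimately show ?thesis by (auto simp: null_sets_def)
  qed
  have "nonunique K = (\<Union>b\<in>Basis. A b)"
  proof (intro equalityI subsetI)
    fix y assume "y \<in> nonunique K"
    then obtain u v where uv: "u \<in> maximizers K y" "v \<in> maximizers K y" "u \<noteq> v"
      by (auto simp: nonunique_def)
    then obtain b where "b \<in> Basis" "inner u b \<noteq> inner v b" by (meson euclidean_eqI)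
    with uv show "y \<in> (\<Union>b\<in>Basis. A b)" by (auto simp: A_def neq_iff)
  next
    fix y assume "y \<in> (\<Union>b\<in>Basis. A b)"
    then show "y \<in> nonunique K"
      unfolding A_def nonunique_def by clarify (metis order_less_irrefl)
  qed
  then show ?thesis using A by (auto intro!: null_sets_UN' countable_finite)
qed

text \<open>Positive scaling of \<open>y\<close> does not change its maximizers, so apart from the
  origin the exceptional set is a cone. This transfers its nullity from the ambient space to the
  sphere.\<close>

lemma sgn_in_nonunique_iff:
  assumes "y \<noteq> 0" shows "sgn y \<in> nonunique K \<longleftrightarrow> y \<in> nonunique K"
proof -
  have "maximizers K (sgn y) = maximizers K y"
    using assms by (simp add: maximizers_def sgn_div_norm divide_le_cancel)
  then show ?thesis by (simp add: nonunique_def)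
qed

subsection \<open>The surface measure of the sphere\<close>

lemma space_sph_borel [simp]: "space sph_borel = Sph"
  by (simp add: sph_borel_def space_restrict_space)

lemma sets_sph_borel_iff: "U \<in> sets sph_borel \<longleftrightarrow> U \<subseteq> Sph \<and> U \<in> sets borel"
  by (simp add: sph_borel_def sets_restrict_space_iff borel_closed)

text \<open>\<open>measure_of\<close> falls back to the zero measure unless its set function is
  countably additive. Writing the same set function as a scaled image measure supplies the
  additivity, and with it the values of \<open>sph_sigma\<close>.\<close>

definition cone_measure :: "'a::euclidean_space measure" where
  "cone_measure = scale_measure (ennreal (real DIM('a)))
     (distr (restrict_space lborel (cball 0 1 - {0})) sph_borel sgn)"

lemma sets_cone_measure [simp]: "sets cone_measure = sets sph_borel"
  by (simp add: cone_measure_def)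

lemma space_cone_measure [simp]: "space cone_measure = Sph"
  using sets_eq_imp_space_eq[OF sets_cone_measure] by simp

lemma emeasure_cone_measure:
  fixes U :: "'a::euclidean_space set"
  assumes U: "U \<in> sets sph_borel"
  shows "emeasure cone_measure U = ennreal (real DIM('a)) *
    emeasure lborel {y. 0 < norm y \<and> norm y \<le> 1 \<and> sgn y \<in> U}"
proof -
  have meas: "sgn \<in> restrict_space lborel (cball 0 1 - {0}) \<rightarrow>\<^sub>M (sph_borel :: 'a measure)"
    unfolding sph_borel_def
    by (intro measurable_restrict_space2 measurable_restrict_space1)
      (auto simp: space_restrict_space norm_sgn)
  have "emeasure (distr (restrict_space lborel (cball 0 1 - {0})) sph_borel sgn) U =
     emeasure lborel (sgn -` U \<inter> (cball 0 1 - {0}))"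
    by (subst emeasure_distr[OF meas U], subst emeasure_restrict_space)
      (auto simp: space_restrict_space)
  also have "sgn -` U \<inter> (cball 0 1 - {0}) = {y. 0 < norm y \<and> norm y \<le> 1 \<and> sgn y \<in> U}" by auto
  finally show ?thesis by (simp add: cone_measure_def)
qed

lemma sph_sigma_eq_cone_measure: "sph_sigma = cone_measure"
proof -
  have "sph_sigma = measure_of Sph (sets sph_borel) (emeasure (cone_measure :: 'a measure))"
    unfolding sph_sigma_def
  proof (rule measure_of_eq)
    fix U :: "'a set" assume "U \<in> sigma_sets Sph (sets sph_borel)"
    then have U: "U \<in> sets sph_borel"
      using sets.sigma_sets_eq[of "sph_borel :: 'a measure"] by simp
    then show "ennreal (real DIM('a)) * emeasure lborel {y. 0 < norm y \<and> norm y \<le> 1 \<and> sgn y \<in> U} = emeasure cone_measure U"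
      by (simp add: emeasure_cone_measure)
  qed (use sets.space_closed[of sph_borel] in simp)
  also have "\<dots> = cone_measure"
    using measure_of_of_measure[of "cone_measure :: 'a measure"] by simp
  finally show ?thesis .
qed

lemma sets_sph_sigma [simp, measurable_cong]: "sets sph_sigma = sets sph_borel"
  by (simp add: sph_sigma_eq_cone_measure)

lemma space_sph_sigma [simp]: "space sph_sigma = Sph"
  by (simp add: sph_sigma_eq_cone_measure)

lemma finite_measure_sph_sigma: "finite_measure (sph_sigma :: 'a::euclidean_space measure)"
proof
  have "emeasure lborel {y::'a. 0 < norm y \<and> norm y \<le> 1 \<and> sgn y \<in> Sph} \<le> emeasure lborel (cball (0::'a) 1)"
    by (rule emeasure_mono) auto
  also have "\<dots> < \<infinity>" by (rule emeasure_lborel_cball_finite)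
  finally have "emeasure sph_sigma (Sph :: 'a set) < \<infinity>"
    by (simp add: sph_sigma_eq_cone_measure emeasure_cone_measure sets_sph_borel_iff borel_closed
        ennreal_mult_less_top)
  then show "emeasure sph_sigma (space (sph_sigma :: 'a measure)) \<noteq> \<infinity>" by simp
qed

lemma AE_sph_sigma_unique:
  fixes K :: "'a::euclidean_space set"
  assumes "compact K"
  shows "AE N in sph_sigma. N \<notin> nonunique K"
proof -
  have "nonunique K \<in> sets borel"
    using nonunique_null[OF assms] by (auto simp: null_sets_def)
  then have U: "nonunique K \<inter> Sph \<in> sets sph_borel"
    by (auto simp: sets_sph_borel_iff borel_closed)
  \<comment> \<open>The cone over the exceptional directions stays inside the null set
    \<open>nonunique K\<close>.\<close>
  have "{y. 0 < norm y \<and> norm y \<le> 1 \<and> sgn y \<in> nonunique K \<inter> Sph} \<subseteq> nonunique K"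
    by (auto simp: sgn_in_nonunique_iff)
  then have "emeasure lborel {y. 0 < norm y \<and> norm y \<le> 1 \<and> sgn y \<in> nonunique K \<inter> Sph} = 0"
    using nonunique_null[OF assms] by (metis emeasure_mono le_zero_eq null_setsD1 null_setsD2)
  then have "nonunique K \<inter> Sph \<in> null_sets sph_sigma"
    using U by (simp only: null_sets_def mem_Collect_eq sph_sigma_eq_cone_measure
        emeasure_cone_measure[OF U] sets_cone_measure mult_zero_right simp_thms)
  from AE_not_in[OF this] AE_space show ?thesis by eventually_elim simp
qed

section \<open>Finite measures are determined by integrals of continuous functions\<close>

text \<open>Closed sets form an intersection-stable generator, and the indicator of a closed set is
  the pointwise limit of continuous functions with values in \<open>{0..1}\<close>.\<close>

lemma finite_borel_measures_eqI:
  fixes M N :: "'a::metric_space measure"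
  assumes M: "finite_measure M" "sets M = sets borel" and N: "finite_measure N" "sets N = sets borel"
    and eq: "\<And>f :: 'a \<Rightarrow> real. continuous_on UNIV f \<Longrightarrow> (\<integral>x. f x \<partial>M) = (\<integral>x. f x \<partial>N)"
  shows "M = N"
proof (rule measure_eqI_generator_eq[where E = "Collect closed" and \<Omega> = UNIV and A = "\<lambda>_. UNIV"])
  interpret M: finite_measure M by fact
  interpret N: finite_measure N by fact
  show "Int_stable (Collect closed :: 'a set set)" by (auto simp: Int_stable_def)
  show "sets M = sigma_sets UNIV (Collect closed)" "sets N = sigma_sets UNIV (Collect closed)"
    using M N by (simp_all add: borel_eq_closed)
  show "emeasure M UNIV \<noteq> \<infinity>" for i :: nat by simp
  fix C :: "'a set" assume "C \<in> Collect closed"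
  then have C: "closed C" by simp
  show "emeasure M C = emeasure N C"
  \<comment> \<open>\<open>infdist x {}\<close> is 0 by convention, which would make every
    \<open>f n\<close> constantly 1, so the empty set is treated apart.\<close>
  proof (cases "C = {}")
    case False
    define f where "f n x = max 0 (1 - real n * infdist x C)" for n x
    have f_lim: "(\<lambda>n. f n x) \<longlonglongrightarrow> indicator C x" for x
    proof (cases "x \<in> C")
      case True
      then show ?thesis by (simp add: f_def)
    next
      case x: False
      then have pos: "0 < infdist x C"
        using infdist_pos_not_in_closed[OF C False] by simp
      obtain m where m: "1 < real m * infdist x C"
        using ex_less_of_nat_mult[OF pos] by blast
      have "f n x = 0" if "n \<ge> m" for n
      proof -
        have "real m * infdist x C \<le> real n * infdist x C"
          using that pos by (intro mult_right_mono) auto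
        with m show ?thesis by (simp add: f_def)
      qed
      then have "(\<lambda>n. f n x) \<longlonglongrightarrow> 0"
        by (intro tendsto_eventually) (auto simp: eventually_sequentially)
      with x show ?thesis by simp
    qed
    have cont: "continuous_on UNIV (f n)" for n
      unfolding f_def by (intro continuous_intros)
    have lim: "(\<lambda>n. \<integral>x. f n x \<partial>L) \<longlonglongrightarrow> measure L C" if L: "finite_measure L" "sets L = sets borel" for L
    proof -
      interpret finite_measure L by fact
      note [measurable_cong] = L(2)
      have [measurable]: "C \<in> sets borel" "\<And>n. f n \<in> borel_measurable borel"
        using C cont by (auto intro: borel_measurable_continuous_onI)
      have "(\<lambda>n. \<integral>x. f n x \<partial>L) \<longlonglongrightarrow> (\<integral>x. indicator C x \<partial>L)"
        by (rule integral_dominated_convergence[where w = "\<lambda>_. 1"])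
          (use f_lim in \<open>simp_all add: L(2) measurable_cong_sets[OF L(2) refl], simp add: f_def infdist_nonneg\<close>)
      also have "(\<integral>x. indicator C x \<partial>L) = measure L C"
        using sets_eq_imp_space_eq[OF L(2)] by simp
      finally show ?thesis .
    qed
    have "measure M C = measure N C"
      using LIMSEQ_unique[OF lim[OF M] _] lim[OF N] eq[OF cont] by simp
    then show ?thesis by (simp add: M.emeasure_eq_measure N.emeasure_eq_measure)
  qed simp
qed auto

lemma measurable_ident_sph_borel: "(\<lambda>x. x) \<in> sph_borel \<rightarrow>\<^sub>M borel"
  by (simp add: sph_borel_def measurable_restrict_space1)

text \<open>Pushing forward along the inclusion reduces this to Borel measures on the ambient space;
  a subset of the sphere is its own preimage.\<close>

lemma finite_sph_measures_eqI:
  fixes M N :: "'a::euclidean_space measure"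
  assumes M: "finite_measure M" "sets M = sets sph_borel" and N: "finite_measure N" "sets N = sets sph_borel"
    and eq: "\<And>f :: 'a \<Rightarrow> real. continuous_on UNIV f \<Longrightarrow> (\<integral>x. f x \<partial>M) = (\<integral>x. f x \<partial>N)"
  shows "M = N"
proof (rule measure_eqI)
  have id: "(\<lambda>x. x) \<in> L \<rightarrow>\<^sub>M borel" if "sets L = sets (sph_borel :: 'a measure)" for L
    using measurable_ident_sph_borel by (subst measurable_cong_sets[OF that refl])
  have "distr M borel (\<lambda>x. x) = distr N borel (\<lambda>x. x)"
  proof (rule finite_borel_measures_eqI)
    fix f :: "'a \<Rightarrow> real" assume f: "continuous_on UNIV f"
    then show "(\<integral>x. f x \<partial>distr M borel (\<lambda>x. x)) = (\<integral>x. f x \<partial>distr N borel (\<lambda>x. x))"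
      using eq[OF f] by (simp add: integral_distr id M N borel_measurable_continuous_onI)
  qed (use M N in \<open>auto intro!: finite_measure.finite_measure_distr id\<close>)
  moreover fix U assume "U \<in> sets M"
  ultimately show "emeasure M U = emeasure N U"
    using emeasure_distr[OF id[OF M(2)], of U] emeasure_distr[OF id[OF N(2)], of U]
      sets.sets_into_space[of U M] sets.sets_into_space[of U N] M N
    by (simp add: sets_sph_borel_iff Int_absorb2)
qed (simp add: M N)

lemma bounded_continuous_on_Sph:
  fixes f :: "'a::euclidean_space \<Rightarrow> real"
  assumes "continuous_on Sph f"
  obtains B where "0 < B" "\<And>x. x \<in> Sph \<Longrightarrow> \<bar>f x\<bar> \<le> B"
proof -
  have "bounded (f ` Sph)"
    using assms by (intro compact_imp_bounded compact_continuous_image) auto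
  then obtain B where "0 < B" "\<forall>y\<in>f ` Sph. norm y \<le> B" unfolding bounded_pos by blast
  then show ?thesis by (intro that[of B]) auto
qed

lemma integrable_continuous_on_Sph:
  fixes g :: "'a::euclidean_space \<Rightarrow> real"
  assumes M: "finite_measure M" "sets M = sets sph_borel" and g: "continuous_on Sph g"
  shows "integrable M g"
proof -
  interpret finite_measure M by fact
  have "g \<in> borel_measurable M"
    using borel_measurable_continuous_on_restrict[OF g]
    by (simp add: measurable_cong_sets[OF M(2) refl] sph_borel_def)
  moreover obtain B where "\<And>x. x \<in> Sph \<Longrightarrow> \<bar>g x\<bar> \<le> B"
    using bounded_continuous_on_Sph[OF g] by blast
  then have "AE x in M. norm (g x) \<le> B"
    using sets_eq_imp_space_eq[OF M(2)] by (intro AE_I2) auto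
  ultimately show ?thesis by (intro integrable_const_bound)
qed

lemma Sph_nonempty: "Sph \<noteq> ({} :: 'a::euclidean_space set)"
  using SOME_Basis by (metis empty_iff mem_sphere_0 norm_Basis)

subsection \<open>Support functions and contact points\<close>

text \<open>Such a \<rho> is the radial function of a closed hypersurface that is star-shaped about
  the origin.\<close>

definition radial :: "('a::euclidean_space \<Rightarrow> real) \<Rightarrow> bool" where
  "radial \<rho> \<longleftrightarrow> continuous_on Sph \<rho> \<and> (\<forall>x\<in>Sph. 0 < \<rho> x)"

definition support_fun :: "('a::euclidean_space \<Rightarrow> real) \<Rightarrow> 'a \<Rightarrow> real" where
  "support_fun \<rho> y = (SUP x\<in>Sph. \<rho> x * inner x y)"

lemma support_fun_attained:
  assumes "radial \<rho>"
  shows "\<exists>x\<in>Sph. support_fun \<rho> y = \<rho> x * inner x y \<and> (\<forall>x'\<in>Sph. \<rho> x' * inner x' y \<le> \<rho> x * inner x y)"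
proof -
  have "continuous_on Sph (\<lambda>x. \<rho> x * inner x y)"
    using assms by (intro continuous_intros) (auto simp: radial_def)
  from continuous_attains_sup[OF compact_sphere Sph_nonempty this]
  obtain x where x: "x \<in> Sph" "\<forall>x'\<in>Sph. \<rho> x' * inner x' y \<le> \<rho> x * inner x y" by blast
  then have "support_fun \<rho> y = \<rho> x * inner x y"
    unfolding support_fun_def by (intro cSup_eq_maximum) auto
  with x show ?thesis by blast
qed

lemma support_fun_upper:
  assumes "radial \<rho>" "x \<in> Sph"
  shows "\<rho> x * inner x y \<le> support_fun \<rho> y"
  using support_fun_attained[OF assms(1), of y] assms(2) by auto

lemma support_fun_pos:
  assumes "radial \<rho>" "N \<in> Sph"
  shows "0 < support_fun \<rho> N"
proof -
  have "0 < \<rho> N * inner N N"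
    using assms by (intro mult_pos_pos) (auto simp: radial_def dot_square_norm)
  with support_fun_upper[OF assms(1,2), of N] show ?thesis by simp
qed

text \<open>A supremum of linear functionals of norm at most \<open>B\<close> is
  \<open>B\<close>-Lipschitz, where \<open>B\<close> bounds \<rho> on the sphere.\<close>

lemma continuous_on_support_fun:
  fixes \<rho> :: "'a::euclidean_space \<Rightarrow> real"
  assumes \<rho>: "radial \<rho>"
  shows "continuous_on S (support_fun \<rho>)"
proof -
  obtain B where B: "B \<ge> 0" "\<And>x. x \<in> Sph \<Longrightarrow> \<bar>\<rho> x\<bar> \<le> B"
    using bounded_continuous_on_Sph[of \<rho>] \<rho> by (metis less_imp_le radial_def)
  have le: "support_fun \<rho> y - support_fun \<rho> y' \<le> B * dist y y'" for y y'
  proof -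
    obtain x where x: "x \<in> Sph" "support_fun \<rho> y = \<rho> x * inner x y"
      using support_fun_attained[OF \<rho>] by blast
    have "support_fun \<rho> y - support_fun \<rho> y' \<le> \<rho> x * inner x y - \<rho> x * inner x y'"
      using x support_fun_upper[OF \<rho> x(1), of y'] by simp
    also have "\<dots> = \<rho> x * inner x (y - y')" by (simp add: inner_diff_right algebra_simps)
    also have "\<dots> \<le> \<bar>\<rho> x\<bar> * \<bar>inner x (y - y')\<bar>" by (metis abs_ge_self abs_mult)
    also have "\<dots> \<le> B * norm (y - y')"
      using B x Cauchy_Schwarz_ineq2[of x "y - y'"] by (intro mult_mono) auto
    finally show ?thesis by (simp add: dist_norm)
  qed
  have "B-lipschitz_on S (support_fun \<rho>)"
  proof (rule lipschitz_onI)
    fix y y' show "dist (support_fun \<rho> y) (support_fun \<rho> y') \<le> B * dist y y'"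
      using le[of y y'] le[of y' y] by (simp add: dist_real_def dist_commute)
  qed fact
  then show ?thesis by (rule lipschitz_on_continuous_on)
qed

lemma admissible_support_fun:
  assumes "radial \<rho>"
  shows "admissible (support_fun \<rho>) \<rho>"
  unfolding admissible_def
proof (intro conjI ballI impI)
  fix x N :: 'a assume x: "x \<in> Sph" "N \<in> Sph" "0 < inner x N"
  have "ln (\<rho> x * inner x N) \<le> ln (support_fun \<rho> N)"
    using x assms support_fun_upper[OF assms x(1), of N] by (intro ln_mono) (auto simp: radial_def)
  then show "ln (inner x N) \<le> ln (support_fun \<rho> N) - ln (\<rho> x)"
    using x assms by (subst (asm) ln_mult_pos) (auto simp: radial_def)
qed (use assms in \<open>auto simp: radial_def support_fun_pos[OF assms] continuous_on_support_fun\<close>)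

text \<open>The support value at \<open>N\<close> is positive, so the point attaining it has a
  positive inner product with \<open>N\<close>, and there the admissibility inequality applies.
  Hence \<open>support_fun \<rho>\<close> is the least partner of \<rho>.\<close>

lemma support_fun_le_admissible:
  assumes "admissible h \<rho>" "N \<in> Sph"
  shows "support_fun \<rho> N \<le> h N"
proof -
  have \<rho>: "radial \<rho>" using assms by (auto simp: admissible_def radial_def)
  obtain x where x: "x \<in> Sph" "support_fun \<rho> N = \<rho> x * inner x N"
    using support_fun_attained[OF \<rho>] by blast
  have pos: "0 < \<rho> x" "0 < h N" using assms x by (auto simp: admissible_def)
  then have inner: "0 < inner x N"
    using support_fun_pos[OF \<rho> assms(2)] x by (simp add: zero_less_mult_iff)
  then have "ln (\<rho> x * inner x N) \<le> ln (h N)"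
    using assms x pos by (subst ln_mult_pos) (auto simp: admissible_def algebra_simps)
  then show ?thesis using x pos inner by (subst (asm) ln_le_cancel_iff) auto
qed

section \<open>A Borel selection of maximizers\<close>

text \<open>A fixed element of \<open>K\<close> is chosen at all points with several maximizers, so that
  \<open>maximizer K\<close> is Borel measurable.\<close>
definition maximizer :: "'a::euclidean_space set \<Rightarrow> 'a \<Rightarrow> 'a" where
  "maximizer K y = (SOME z. if y \<in> nonunique K then z \<in> K else z \<in> maximizers K y)"

lemma maximizer_in_maximizers:
  assumes "compact K" "K \<noteq> {}" "y \<notin> nonunique K"
  shows "maximizer K y \<in> maximizers K y"
  using assms maximizers_exist[of K y] unfolding maximizer_def by (auto intro: someI_ex)

lemma maximizer_in:
  assumes "compact K" "K \<noteq> {}"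
  shows "maximizer K y \<in> K"
proof (cases "y \<in> nonunique K")
  case True
  then show ?thesis using assms by (auto simp: maximizer_def some_in_eq)
qed (use maximizer_in_maximizers[OF assms, of y] in \<open>auto simp: maximizers_def\<close>)

text \<open>Off the Borel set \<open>nonunique K\<close> the preimage of a closed \<open>C\<close>
  is the closed set of points having some maximizer in \<open>C\<close>; on
  \<open>nonunique K\<close> the selection is constant.\<close>

lemma measurable_maximizer:
  fixes K :: "'a::euclidean_space set"
  assumes K: "compact K" "K \<noteq> {}"
  shows "maximizer K \<in> borel \<rightarrow>\<^sub>M borel"
  unfolding borel_eq_closed[where 'a = 'a]
proof (rule measurable_measure_of)
  fix C :: "'a set" assume "C \<in> Collect closed"
  then have C: "closed C" by simp
  define e where "e = (SOME z. z \<in> K)"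
  have e: "maximizer K y = e" if "y \<in> nonunique K" for y
    using that by (simp add: maximizer_def e_def)
  have uniq: "z = maximizer K y" if "y \<notin> nonunique K" "z \<in> maximizers K y" for y z
    using that maximizer_in_maximizers[OF K that(1)] by (auto simp: nonunique_def)
  have "maximizer K -` C = ({y. \<exists>z\<in>C. z \<in> maximizers K y} - nonunique K) \<union>
      (if e \<in> C then nonunique K else {})"
    using e uniq maximizer_in_maximizers[OF K] by (auto split: if_splits; metis)
  also have "\<dots> \<in> sets borel"
    using closed_maximizers_meets[OF K(1) C] nonunique_null[OF K(1)]
    by (intro sets.Un sets.Diff) (auto simp: null_sets_def intro: borel_closed)
  finally show "maximizer K -` C \<inter> space (sigma UNIV (Collect closed)) \<in> sets (sigma UNIV (Collect closed))"
    by (simp add: borel_eq_closed)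
qed auto

section \<open>Radial graphs and their contact points\<close>

definition radial_graph :: "('a::euclidean_space \<Rightarrow> real) \<Rightarrow> 'a set" where
  "radial_graph \<rho> = (\<lambda>x. \<rho> x *\<^sub>R x) ` Sph"

text \<open>For almost every \<open>N\<close> this is the direction of the point where the
  supporting hyperplane with outer normal \<open>N\<close> touches the graph: a generalized inverse
  Gauss map. \<open>sgn\<close> recovers \<open>x\<close> from
  \<open>\<rho> x *\<^sub>R x\<close>.\<close>

definition contact :: "('a::euclidean_space \<Rightarrow> real) \<Rightarrow> 'a \<Rightarrow> 'a" where
  "contact \<rho> N = sgn (maximizer (radial_graph \<rho>) N)"

lemma radial_graph_compact:
  assumes "radial \<rho>"
  shows "compact (radial_graph \<rho>)"
  unfolding radial_graph_def using assms
  by (intro compact_continuous_image continuous_intros) (auto simp: radial_def)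

lemma radial_graph_nonempty: "radial_graph \<rho> \<noteq> {}"
  by (simp add: radial_graph_def Sph_nonempty)

lemma sgn_scaleR_radial:
  assumes "radial \<rho>" "x \<in> Sph"
  shows "sgn (\<rho> x *\<^sub>R x) = x"
proof -
  have "0 < \<rho> x" using assms by (simp add: radial_def)
  then show ?thesis using assms by (simp add: sgn_scaleR sgn_div_norm)
qed

lemma contact_in_Sph:
  assumes "radial \<rho>"
  shows "contact \<rho> N \<in> Sph"
  using maximizer_in[OF radial_graph_compact[OF assms] radial_graph_nonempty, of N]
  by (auto simp: radial_graph_def contact_def sgn_scaleR_radial[OF assms])

lemma measurable_contact:
  fixes \<rho> :: "'a::euclidean_space \<Rightarrow> real"
  assumes "radial \<rho>"
  shows "contact \<rho> \<in> sph_borel \<rightarrow>\<^sub>M sph_borel"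
proof -
  have "contact \<rho> \<in> borel \<rightarrow>\<^sub>M borel"
    unfolding contact_def
    using measurable_maximizer[OF radial_graph_compact[OF assms] radial_graph_nonempty]
    by measurable
  then show ?thesis
    unfolding sph_borel_def
    by (intro measurable_restrict_space2 measurable_restrict_space1)
      (use contact_in_Sph[OF assms] in auto)
qed

lemma contact_attains:
  fixes \<rho> :: "'a::euclidean_space \<Rightarrow> real"
  assumes \<rho>: "radial \<rho>" and N: "N \<notin> nonunique (radial_graph \<rho>)"
  shows "\<rho> (contact \<rho> N) * inner (contact \<rho> N) N = support_fun \<rho> N"
proof -
  have "maximizer (radial_graph \<rho>) N \<in> maximizers (radial_graph \<rho>) N"
    using maximizer_in_maximizers[OF radial_graph_compact[OF \<rho>] radial_graph_nonempty N] .
  then obtain x where x: "x \<in> Sph" "maximizer (radial_graph \<rho>) N = \<rho> x *\<^sub>R x"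
      "\<forall>x'\<in>Sph. \<rho> x' * inner x' N \<le> \<rho> x * inner x N"
    by (auto simp: maximizers_def radial_graph_def)
  have "contact \<rho> N = x" using x by (simp only: contact_def sgn_scaleR_radial[OF \<rho>])
  moreover have "support_fun \<rho> N = \<rho> x * inner x N"
    using support_fun_attained[OF \<rho>, of N] x by force
  ultimately show ?thesis by simp
qed

lemma contact_unique:
  fixes \<rho> :: "'a::euclidean_space \<Rightarrow> real"
  assumes \<rho>: "radial \<rho>" and N: "N \<notin> nonunique (radial_graph \<rho>)"
    and x: "x \<in> Sph" "\<rho> x * inner x N = support_fun \<rho> N"
  shows "x = contact \<rho> N"
proof -
  have "maximizer (radial_graph \<rho>) N \<in> maximizers (radial_graph \<rho>) N"
    using maximizer_in_maximizers[OF radial_graph_compact[OF \<rho>] radial_graph_nonempty N] .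
  moreover have "\<rho> x *\<^sub>R x \<in> maximizers (radial_graph \<rho>) N"
    using x support_fun_upper[OF \<rho>] by (auto simp: maximizers_def radial_graph_def)
  ultimately have "maximizer (radial_graph \<rho>) N = \<rho> x *\<^sub>R x"
    using N by (auto simp: nonunique_def)
  then show ?thesis by (simp add: contact_def sgn_scaleR_radial[OF \<rho> x(1)])
qed

subsection \<open>First variation\<close>

text \<open>The exponential factor keeps the function positive for every \<open>t\<close> and makes
  its logarithm affine in \<open>t\<close>.\<close>

definition perturb :: "('a::euclidean_space \<Rightarrow> real) \<Rightarrow> ('a \<Rightarrow> real) \<Rightarrow> real \<Rightarrow> 'a \<Rightarrow> real" where
  "perturb \<rho> f t x = \<rho> x * exp (t * f x)"

lemma radial_perturb:
  assumes "radial \<rho>" "continuous_on UNIV f"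
  shows "radial (perturb \<rho> f t)"
  using assms continuous_on_subset[OF assms(2), of Sph] unfolding radial_def perturb_def
  by (auto intro!: continuous_intros)

text \<open>Each maximizer is a competitor in the other problem: \<open>x\<close> tested in the
  perturbed supremum gives the lower bound, \<open>x'\<close> tested in the original one gives the
  upper bound.\<close>

lemma ln_support_fun_perturb_bounds:
  fixes \<rho> :: "'a::euclidean_space \<Rightarrow> real"
  assumes \<rho>: "radial \<rho>" and f: "continuous_on UNIV f" and N: "N \<in> Sph"
    and x: "x \<in> Sph" "support_fun \<rho> N = \<rho> x * inner x N"
  obtains x' where "x' \<in> Sph" "support_fun (perturb \<rho> f t) N = perturb \<rho> f t x' * inner x' N"
    "t * f x \<le> ln (support_fun (perturb \<rho> f t) N) - ln (support_fun \<rho> N)"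
    "ln (support_fun (perturb \<rho> f t) N) - ln (support_fun \<rho> N) \<le> t * f x'"
proof -
  have \<rho>': "radial (perturb \<rho> f t)" using radial_perturb[OF \<rho> f] .
  note pos = support_fun_pos[OF \<rho> N] support_fun_pos[OF \<rho>' N]
  obtain x' where x': "x' \<in> Sph" "support_fun (perturb \<rho> f t) N = perturb \<rho> f t x' * inner x' N"
    using support_fun_attained[OF \<rho>'] by blast
  have "exp (t * f x) * support_fun \<rho> N \<le> support_fun (perturb \<rho> f t) N"
    using support_fun_upper[OF \<rho>' x(1), of N] x(2) by (simp add: perturb_def algebra_simps)
  then have "ln (exp (t * f x) * support_fun \<rho> N) \<le> ln (support_fun (perturb \<rho> f t) N)"
    using pos by (intro ln_mono) auto
  then have 1: "t * f x \<le> ln (support_fun (perturb \<rho> f t) N) - ln (support_fun \<rho> N)"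
    using pos by (simp add: ln_mult_pos)
  have "support_fun (perturb \<rho> f t) N = exp (t * f x') * (\<rho> x' * inner x' N)"
    using x' by (simp add: perturb_def)
  also have "\<dots> \<le> exp (t * f x') * support_fun \<rho> N"
    using support_fun_upper[OF \<rho> x'(1), of N] by simp
  finally have "ln (support_fun (perturb \<rho> f t) N) \<le> ln (exp (t * f x') * support_fun \<rho> N)"
    using pos by (intro ln_mono) auto
  then have "ln (support_fun (perturb \<rho> f t) N) - ln (support_fun \<rho> N) \<le> t * f x'"
    using pos by (simp add: ln_mult_pos)
  with x' 1 that show ?thesis by blast
qed

definition ln_support_quotient :: "('a::euclidean_space \<Rightarrow> real) \<Rightarrow> ('a \<Rightarrow> real) \<Rightarrow> real \<Rightarrow> 'a \<Rightarrow> real" where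
  "ln_support_quotient \<rho> f t N = (ln (support_fun (perturb \<rho> f t) N) - ln (support_fun \<rho> N)) / t"

text \<open>The quotient lies between two values of \<open>f\<close> on the sphere. This is the
  dominating bound for passing to the limit under the integral.\<close>

lemma ln_support_quotient_bounded:
  assumes \<rho>: "radial \<rho>" and f: "continuous_on UNIV f" and N: "N \<in> Sph" and t: "0 < t"
    and B: "\<And>x. x \<in> Sph \<Longrightarrow> \<bar>f x\<bar> \<le> B"
  shows "\<bar>ln_support_quotient \<rho> f t N\<bar> \<le> B"
proof -
  obtain x where x: "x \<in> Sph" "support_fun \<rho> N = \<rho> x * inner x N"
    using support_fun_attained[OF \<rho>] by blast
  obtain x' where x': "x' \<in> Sph" and *: "t * f x \<le> ln (support_fun (perturb \<rho> f t) N) - ln (support_fun \<rho> N)"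
    "ln (support_fun (perturb \<rho> f t) N) - ln (support_fun \<rho> N) \<le> t * f x'"
    using ln_support_fun_perturb_bounds[OF \<rho> f N x, of t] by metis
  have "f x \<le> ln_support_quotient \<rho> f t N" "ln_support_quotient \<rho> f t N \<le> f x'"
    using * t by (simp_all add: ln_support_quotient_def field_simps)
  with B[OF x(1)] B[OF x'] show ?thesis by simp
qed

text \<open>The derivative of the logarithmic support function only involves the contact point:
  maximizers of the perturbed problem are almost maximizers of the original one, so uniqueness
  forces them towards the contact point.\<close>
lemma ln_support_quotient_tendsto:
  fixes \<rho> :: "'a::euclidean_space \<Rightarrow> real"
  assumes \<rho>: "radial \<rho>" and f: "continuous_on UNIV f" and N: "N \<in> Sph"
    and uniq: "N \<notin> nonunique (radial_graph \<rho>)"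
  shows "((\<lambda>t. ln_support_quotient \<rho> f t N) \<longlongrightarrow> f (contact \<rho> N)) (at_right 0)"
proof (rule tendstoI)
  fix e :: real assume e: "0 < e"
  let ?x = "contact \<rho> N"
  define \<phi> where "\<phi> x = \<rho> x * inner x N" for x
  have x: "?x \<in> Sph" "support_fun \<rho> N = \<rho> ?x * inner ?x N"
    using contact_in_Sph[OF \<rho>] contact_attains[OF \<rho> uniq] by auto
  have pos: "0 < support_fun \<rho> N" using support_fun_pos[OF \<rho> N] .
  \<comment> \<open>\<open>C\<close> collects the points at which \<open>f\<close> is too far from
    its value at the contact point; the perturbed maximizer has to avoid it.\<close>
  define C where "C = Sph \<inter> {x. e \<le> dist (f x) (f ?x)}"
  have "compact C"
    unfolding C_def using f by (intro compact_Int_closed closed_Collect_le continuous_intros) auto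
  \<comment> \<open>By compactness and uniqueness of the contact point, \<open>\<phi>\<close> stays
    away from its maximum on \<open>C\<close>. Half the support value keeps \<open>m\<close>
    positive and also serves when \<open>C\<close> is empty.\<close>
  have "\<exists>m>0. m < support_fun \<rho> N \<and> (\<forall>x\<in>C. \<phi> x \<le> m)"
  proof (cases "C = {}")
    case True
    then show ?thesis using pos by (auto intro!: exI[of _ "support_fun \<rho> N / 2"])
  next
    case False
    have "continuous_on C \<phi>"
      unfolding \<phi>_def C_def using \<rho>
      by (intro continuous_intros) (auto simp: radial_def intro: continuous_on_subset)
    from continuous_attains_sup[OF \<open>compact C\<close> False this]
    obtain z where z: "z \<in> C" "\<forall>y\<in>C. \<phi> y \<le> \<phi> z" by blast
    have "z \<noteq> ?x" using z e by (auto simp: C_def)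
    then have "\<phi> z \<noteq> support_fun \<rho> N"
      using contact_unique[OF \<rho> uniq, of z] z by (auto simp: C_def \<phi>_def)
    moreover have "\<phi> z \<le> support_fun \<rho> N"
      using support_fun_upper[OF \<rho>, of z N] z by (auto simp: C_def \<phi>_def)
    ultimately have "max (\<phi> z) (support_fun \<rho> N / 2) < support_fun \<rho> N" using pos by simp
    then show ?thesis using z pos
      by (intro exI[of _ "max (\<phi> z) (support_fun \<rho> N / 2)"]) (auto simp: le_max_iff_disj)
  qed
  then obtain m where m: "0 < m" "m < support_fun \<rho> N" "\<And>x. x \<in> C \<Longrightarrow> \<phi> x \<le> m" by blast
  obtain B where B: "0 < B" "\<And>x. x \<in> Sph \<Longrightarrow> \<bar>f x\<bar> \<le> B"
    using bounded_continuous_on_Sph[OF continuous_on_subset[OF f subset_UNIV]] by blast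
  \<comment> \<open>Two values of \<open>f\<close> on the sphere differ by at most
    \<open>2 * B\<close>, so the perturbation favours a point of \<open>C\<close> over the contact
    point by a factor of at most \<open>exp (2 * B * t)\<close>, too little for small
    \<open>t\<close>.\<close>
  have "((\<lambda>t::real. exp (2 * B * t) * m) \<longlongrightarrow> exp (2 * B * 0) * m) (at_right 0)"
    by (intro tendsto_intros)
  then have "\<forall>\<^sub>F t in at_right 0. exp (2 * B * t) * m < support_fun \<rho> N"
    using m by (intro order_tendstoD) simp
  then show "\<forall>\<^sub>F t in at_right 0. dist (ln_support_quotient \<rho> f t N) (f ?x) < e"
    using eventually_at_right_less[of 0]
  proof eventually_elim
    case (elim t)
    obtain x' where x': "x' \<in> Sph" "support_fun (perturb \<rho> f t) N = perturb \<rho> f t x' * inner x' N"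
      and *: "t * f ?x \<le> ln (support_fun (perturb \<rho> f t) N) - ln (support_fun \<rho> N)"
      "ln (support_fun (perturb \<rho> f t) N) - ln (support_fun \<rho> N) \<le> t * f x'"
      using ln_support_fun_perturb_bounds[OF \<rho> f N x, of t] by metis
    have q: "f ?x \<le> ln_support_quotient \<rho> f t N" "ln_support_quotient \<rho> f t N \<le> f x'"
      using * elim by (simp_all add: ln_support_quotient_def field_simps)
    have "x' \<notin> C"
    proof
      assume "x' \<in> C"
      have "exp (t * f ?x) * support_fun \<rho> N \<le> exp (t * f x') * \<phi> x'"
        using support_fun_upper[OF radial_perturb[OF \<rho> f] x(1), of t N] x x'
        by (simp add: perturb_def \<phi>_def algebra_simps)
      also have "\<dots> \<le> exp (t * f x') * m"
        using m(3)[OF \<open>x' \<in> C\<close>] by simp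
      finally have "support_fun \<rho> N \<le> exp (t * f x' - t * f ?x) * m"
        by (simp add: exp_diff field_simps)
      also have "\<dots> \<le> exp (2 * B * t) * m"
      proof -
        have "f x' - f ?x \<le> 2 * B" using B(2)[OF x(1)] B(2)[OF x'(1)] by simp
        then have "t * (f x' - f ?x) \<le> t * (2 * B)" using elim by (intro mult_left_mono) auto
        then show ?thesis using m(1) by (simp add: algebra_simps)
      qed
      finally show False using elim by simp
    qed
    then have "dist (f x') (f ?x) < e" using x' by (auto simp: C_def)
    with q show ?case by (simp add: dist_real_def)
  qed
qed

section \<open>The minimality condition and the push-forward of the surface measure\<close>

lemma continuous_on_ln_support_fun:
  assumes "radial \<rho>"
  shows "continuous_on Sph (\<lambda>N. ln (support_fun \<rho> N))"
  using support_fun_pos[OF assms]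
  by (intro continuous_on_ln continuous_on_support_fun[OF assms]) force

lemma continuous_on_ln_radial:
  assumes "radial \<rho>"
  shows "continuous_on Sph (\<lambda>x. ln (\<rho> x))"
  using assms by (intro continuous_on_ln) (force simp: radial_def)+

lemma admissible_radial:
  assumes "admissible h \<rho>"
  shows "radial \<rho>" "radial h"
  using assms by (auto simp: radial_def admissible_def)

lemmas integrable_sph_sigma = integrable_continuous_on_Sph[OF finite_measure_sph_sigma sets_sph_sigma]

lemma Qfun_support_fun_le:
  assumes adm: "admissible h \<rho>"
  shows "Qfun \<mu> (support_fun \<rho>) \<rho> \<le> Qfun \<mu> h \<rho>"
proof -
  note \<rho> = admissible_radial(1)[OF adm]
  have "(\<integral>N. ln (support_fun \<rho> N) \<partial>sph_sigma) \<le> (\<integral>N. ln (h N) \<partial>sph_sigma)"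
  proof (rule integral_mono)
    show "integrable sph_sigma (\<lambda>N. ln (support_fun \<rho> N))" "integrable sph_sigma (\<lambda>N. ln (h N))"
      using \<rho> admissible_radial(2)[OF adm]
      by (simp_all add: integrable_sph_sigma continuous_on_ln_support_fun continuous_on_ln_radial)
    fix N :: 'a assume "N \<in> space sph_sigma"
    then have "N \<in> Sph" by simp
    then show "ln (support_fun \<rho> N) \<le> ln (h N)"
      using support_fun_pos[OF \<rho>, of N] support_fun_le_admissible[OF adm, of N]
      by (intro ln_mono) auto
  qed
  then show ?thesis by (simp add: Qfun_def)
qed

text \<open>The one-sided derivative of the functional along \<open>perturb \<rho> f t\<close>, each
  time with the support function as partner, cannot be negative at a minimizer; dominated
  convergence evaluates it.\<close>

lemma integral_le_contact_integral:
  fixes \<mu> :: "'a::euclidean_space measure" and f :: "'a \<Rightarrow> real"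
  assumes \<mu>: "finite_measure \<mu>" "sets \<mu> = sets sph_borel" and adm: "admissible h \<rho>"
    and minimizer: "\<And>h' \<rho>'. admissible h' \<rho>' \<Longrightarrow> Qfun \<mu> h \<rho> \<le> Qfun \<mu> h' \<rho>'"
    and f: "continuous_on UNIV f"
  shows "(\<integral>x. f x \<partial>\<mu>) \<le> (\<integral>N. f (contact \<rho> N) \<partial>sph_sigma)"
proof -
  note \<rho> = admissible_radial(1)[OF adm]
  note int_mu = integrable_continuous_on_Sph[OF \<mu>]
  have f_Sph: "continuous_on Sph f" using f by (rule continuous_on_subset) simp
  define D where "D n = ln_support_quotient \<rho> f (inverse (real (Suc n)))" for n
  have D_int: "integrable sph_sigma (D n)" for n
    unfolding D_def ln_support_quotient_def
    by (intro integrable_divide Bochner_Integration.integrable_diff integrable_sph_sigma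
        continuous_on_ln_support_fun radial_perturb \<rho> f)
  have le: "(\<integral>x. f x \<partial>\<mu>) \<le> (\<integral>N. D n N \<partial>sph_sigma)" for n
  proof -
    define t where "t = inverse (real (Suc n))"
    have t: "0 < t" by (simp add: t_def)
    note \<rho>' = radial_perturb[OF \<rho> f, of t]
    have "(\<integral>x. ln (perturb \<rho> f t x) \<partial>\<mu>) = (\<integral>x. ln (\<rho> x) + t * f x \<partial>\<mu>)"
    proof (rule Bochner_Integration.integral_cong[OF refl])
      fix x assume "x \<in> space \<mu>"
      then have "0 < \<rho> x"
        using \<rho> sets_eq_imp_space_eq[OF \<mu>(2)] by (simp add: radial_def)
      then show "ln (perturb \<rho> f t x) = ln (\<rho> x) + t * f x"
        by (simp add: perturb_def ln_mult_pos)
    qed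
    also have "\<dots> = (\<integral>x. ln (\<rho> x) \<partial>\<mu>) + t * (\<integral>x. f x \<partial>\<mu>)"
      using int_mu[OF continuous_on_ln_radial[OF \<rho>]] int_mu[OF f_Sph] by simp
    finally have "t * (\<integral>x. f x \<partial>\<mu>) = (\<integral>x. ln (perturb \<rho> f t x) \<partial>\<mu>) - (\<integral>x. ln (\<rho> x) \<partial>\<mu>)"
      by simp
    \<comment> \<open>The value at \<open>h\<close> sits between those of the two support-function
      pairs: replacing \<open>h\<close> by \<open>support_fun \<rho>\<close> does not raise it, and
      the perturbed pair does not beat it.\<close>
    also have "\<dots> \<le> (\<integral>N. ln (support_fun (perturb \<rho> f t) N) \<partial>sph_sigma) - (\<integral>N. ln (support_fun \<rho> N) \<partial>sph_sigma)"
      using minimizer[OF admissible_support_fun[OF \<rho>']] Qfun_support_fun_le[OF adm, of \<mu>]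
      by (simp add: Qfun_def)
    also have "\<dots> = t * (\<integral>N. D n N \<partial>sph_sigma)"
      using t integrable_sph_sigma[OF continuous_on_ln_support_fun[OF \<rho>]]
        integrable_sph_sigma[OF continuous_on_ln_support_fun[OF \<rho>']]
      by (simp add: D_def ln_support_quotient_def t_def[symmetric] del: of_nat_Suc)
    finally show ?thesis using t by simp
  qed
  obtain B where B: "\<And>x. x \<in> Sph \<Longrightarrow> \<bar>f x\<bar> \<le> B"
    using bounded_continuous_on_Sph[OF f_Sph] by blast
  have "(\<lambda>n. \<integral>N. D n N \<partial>sph_sigma) \<longlonglongrightarrow> (\<integral>N. f (contact \<rho> N) \<partial>sph_sigma)"
  proof (rule integral_dominated_convergence[where w = "\<lambda>_. B"])
    show "integrable sph_sigma (\<lambda>_. B)" by (simp add: integrable_sph_sigma)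
    have "f \<in> borel_measurable sph_borel"
      using borel_measurable_continuous_on_restrict[OF f_Sph] by (simp add: sph_borel_def)
    then show "(\<lambda>N. f (contact \<rho> N)) \<in> borel_measurable sph_sigma"
      using measurable_contact[OF \<rho>] by measurable
    show "AE N in sph_sigma. norm (D n N) \<le> B" for n
      using ln_support_quotient_bounded[OF \<rho> f _ _ B] by (intro AE_I2) (simp add: D_def)
    have seq: "filterlim (\<lambda>n. inverse (real (Suc n))) (at_right 0) sequentially"
      using LIMSEQ_inverse_real_of_nat by (auto simp: filterlim_at)
    show "AE N in sph_sigma. (\<lambda>n. D n N) \<longlonglongrightarrow> f (contact \<rho> N)"
      using AE_sph_sigma_unique[OF radial_graph_compact[OF \<rho>]] AE_space
    proof eventually_elim
      case (elim N)
      then show ?case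
        unfolding D_def
        using filterlim_compose[OF ln_support_quotient_tendsto[OF \<rho> f, of N] seq] by simp
    qed
  qed (use D_int in auto)
  then show ?thesis using le by (intro LIMSEQ_le_const) auto
qed

text \<open>The one-sided inequality for \<open>f\<close> and for \<open>- f\<close> gives equality
  of integrals for every continuous \<open>f\<close>.\<close>

lemma distr_contact_eq:
  fixes \<mu> :: "'a::euclidean_space measure"
  assumes \<mu>: "finite_measure \<mu>" "sets \<mu> = sets sph_borel" and adm: "admissible h \<rho>"
    and minimizer: "\<And>h' \<rho>'. admissible h' \<rho>' \<Longrightarrow> Qfun \<mu> h \<rho> \<le> Qfun \<mu> h' \<rho>'"
  shows "distr sph_sigma sph_borel (contact \<rho>) = \<mu>"
proof -
  note \<rho> = admissible_radial(1)[OF adm]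
  have T: "contact \<rho> \<in> sph_sigma \<rightarrow>\<^sub>M sph_borel"
    using measurable_contact[OF \<rho>] by measurable
  show ?thesis
  proof (rule finite_sph_measures_eqI)
    show "finite_measure (distr sph_sigma sph_borel (contact \<rho>))"
      by (rule finite_measure.finite_measure_distr[OF finite_measure_sph_sigma T])
    fix f :: "'a \<Rightarrow> real" assume f: "continuous_on UNIV f"
    have "f \<in> borel_measurable sph_borel"
      using f by (simp add: sph_borel_def borel_measurable_continuous_onI measurable_restrict_space1)
    then have "(\<integral>x. f x \<partial>distr sph_sigma sph_borel (contact \<rho>)) = (\<integral>N. f (contact \<rho> N) \<partial>sph_sigma)"
      by (rule integral_distr[OF T])
    moreover have "(\<integral>x. f x \<partial>\<mu>) \<le> (\<integral>N. f (contact \<rho> N) \<partial>sph_sigma)"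
      using integral_le_contact_integral[OF \<mu> adm minimizer f] .
    moreover have "(\<integral>x. - f x \<partial>\<mu>) \<le> (\<integral>N. - f (contact \<rho> N) \<partial>sph_sigma)"
      using integral_le_contact_integral[OF \<mu> adm minimizer, of "\<lambda>x. - f x"] f
      by (simp add: continuous_on_minus)
    ultimately show "(\<integral>x. f x \<partial>distr sph_sigma sph_borel (contact \<rho>)) = (\<integral>x. f x \<partial>\<mu>)"
      by simp
  qed (use \<mu> in auto)
qed

subsection \<open>Duality\<close>

text \<open>The marginal conditions, read as image measures under \<open>fst\<close> and
  \<open>snd\<close>, evaluate the integral of \<open>g\<close> as
  \<open>- Qfun \<mu> h \<rho>\<close>, while admissibility says that \<open>g\<close> is below the
  negated cost wherever that is finite.\<close>

lemma Cost_le_Qfun: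
  fixes \<mu> :: "'a::euclidean_space measure"
  assumes \<mu>: "finite_measure \<mu>" "sets \<mu> = sets sph_borel" and adm: "admissible h \<rho>"
    and \<gamma>: "\<gamma> \<in> Plans \<mu> sph_sigma"
  shows "Cost \<gamma> \<le> ereal (Qfun \<mu> h \<rho>)"
proof -
  note \<rho> = admissible_radial(1)[OF adm] and h = admissible_radial(2)[OF adm]
  have sets_\<gamma>[measurable_cong]: "sets \<gamma> = sets (sph_borel \<Otimes>\<^sub>M sph_borel)"
    using \<gamma> by (simp add: Plans_def)
  have space_\<gamma>: "space \<gamma> = Sph \<times> Sph"
    using sets_eq_imp_space_eq[OF sets_\<gamma>] by (simp add: space_pair_measure)
  have fst: "fst \<in> \<gamma> \<rightarrow>\<^sub>M sph_borel" and snd: "snd \<in> \<gamma> \<rightarrow>\<^sub>M sph_borel" by measurable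
  have distr_fst: "distr \<gamma> sph_borel fst = \<mu>"
  proof (rule measure_eqI)
    fix U assume "U \<in> sets (distr \<gamma> sph_borel fst)"
    then have U: "U \<in> sets sph_borel" by simp
    then have "fst -` U \<inter> space \<gamma> = U \<times> Sph"
      using sets.sets_into_space[OF U] by (auto simp: space_\<gamma>)
    then show "emeasure (distr \<gamma> sph_borel fst) U = emeasure \<mu> U"
      using \<gamma> U by (simp add: emeasure_distr[OF fst U] Plans_def)
  qed (simp add: \<mu>)
  have distr_snd: "distr \<gamma> sph_borel snd = sph_sigma"
  proof (rule measure_eqI)
    fix U assume "U \<in> sets (distr \<gamma> sph_borel snd)"
    then have U: "U \<in> sets sph_borel" by simp
    then have "snd -` U \<inter> space \<gamma> = Sph \<times> U"
      using sets.sets_into_space[OF U] by (auto simp: space_\<gamma>)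
    then show "emeasure (distr \<gamma> sph_borel snd) U = emeasure sph_sigma U"
      using \<gamma> U by (simp add: emeasure_distr[OF snd U] Plans_def)
  qed simp
  have meas: "(\<lambda>x. ln (\<rho> x)) \<in> borel_measurable sph_borel" "(\<lambda>x. ln (h x)) \<in> borel_measurable sph_borel"
    using borel_measurable_continuous_on_restrict[OF continuous_on_ln_radial] \<rho> h
    by (auto simp: sph_borel_def)
  have int: "integrable \<gamma> (\<lambda>p. ln (\<rho> (fst p)))" "integrable \<gamma> (\<lambda>p. ln (h (snd p)))"
    using integrable_continuous_on_Sph[OF \<mu> continuous_on_ln_radial[OF \<rho>]]
      integrable_sph_sigma[OF continuous_on_ln_radial[OF h]]
    by (simp_all add: integrable_distr_eq[OF fst meas(1)] integrable_distr_eq[OF snd meas(2)]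
        flip: distr_fst distr_snd)
  define g where "g p = ln (\<rho> (fst p)) - ln (h (snd p))" for p
  have "(\<integral>p. g p \<partial>\<gamma>) = (\<integral>x. ln (\<rho> x) \<partial>distr \<gamma> sph_borel fst) - (\<integral>N. ln (h N) \<partial>distr \<gamma> sph_borel snd)"
    unfolding g_def using int
    by (simp add: integral_distr[OF fst meas(1)] integral_distr[OF snd meas(2)])
  then have Q: "(\<integral>p. g p \<partial>\<gamma>) = - Qfun \<mu> h \<rho>"
    by (simp add: distr_fst distr_snd Qfun_def)
  have g: "integrable \<gamma> g" unfolding g_def using int by (rule Bochner_Integration.integrable_diff)
  \<comment> \<open>\<open>g\<close> can be negative whereas \<open>neg_cost\<close> is nonnegative,
    so the comparison passes through the positive part of \<open>g\<close>.\<close>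
  have "ennreal (- Qfun \<mu> h \<rho>) \<le> ennreal (\<integral>p. max 0 (g p) \<partial>\<gamma>)"
    unfolding Q[symmetric] using g by (intro ennreal_leI integral_mono) auto
  also have "\<dots> = (\<integral>\<^sup>+p. ennreal (max 0 (g p)) \<partial>\<gamma>)"
    using g by (intro nn_integral_eq_integral[symmetric]) auto
  also have "\<dots> \<le> (\<integral>\<^sup>+p. neg_cost p \<partial>\<gamma>)"
  proof (rule nn_integral_mono)
    fix p assume "p \<in> space \<gamma>"
    then have "fst p \<in> Sph" "snd p \<in> Sph" by (auto simp: space_\<gamma>)
    then have "g p \<le> - ln (inner (fst p) (snd p))" if "0 < inner (fst p) (snd p)"
      using adm that unfolding admissible_def g_def by fastforce
    then show "ennreal (max 0 (g p)) \<le> neg_cost p"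
      by (auto simp: neg_cost_def ennreal_max_0 intro: ennreal_leI)
  qed
  finally have "enn2ereal (ennreal (- Qfun \<mu> h \<rho>)) \<le> enn2ereal (\<integral>\<^sup>+p. neg_cost p \<partial>\<gamma>)"
    by (simp add: less_eq_ennreal.rep_eq)
  \<comment> \<open>\<open>ennreal\<close> sends negative reals to 0, so in general only an
    inequality holds here.\<close>
  moreover have "ereal (- Qfun \<mu> h \<rho>) \<le> enn2ereal (ennreal (- Qfun \<mu> h \<rho>))"
    by (cases "0 \<le> - Qfun \<mu> h \<rho>") (auto simp: ennreal_neg zero_ennreal.rep_eq)
  ultimately have "ereal (- Qfun \<mu> h \<rho>) \<le> enn2ereal (\<integral>\<^sup>+p. neg_cost p \<partial>\<gamma>)" by order
  then show ?thesis
    unfolding Cost_def by (metis ereal_uminus_le_reorder uminus_ereal.simps(1))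
qed

text \<open>On the graph of the contact map the admissibility inequality is almost everywhere an
  equality, so the estimate of weak duality loses nothing.\<close>

lemma contact_plan_attains:
  fixes \<mu> :: "'a::euclidean_space measure"
  assumes \<mu>: "finite_measure \<mu>" "sets \<mu> = sets sph_borel" and \<rho>: "radial \<rho>"
    and distr: "distr sph_sigma sph_borel (contact \<rho>) = \<mu>"
  shows "\<exists>\<gamma>\<in>Plans \<mu> sph_sigma. Cost \<gamma> = ereal (Qfun \<mu> (support_fun \<rho>) \<rho>)"
proof -
  let ?T = "contact \<rho>"
  have T[measurable]: "?T \<in> sph_sigma \<rightarrow>\<^sub>M sph_borel"
    using measurable_contact[OF \<rho>] by measurable
  have P: "(\<lambda>N. (?T N, N)) \<in> sph_sigma \<rightarrow>\<^sub>M sph_borel \<Otimes>\<^sub>M sph_borel" by measurable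
  define \<gamma> where "\<gamma> = distr sph_sigma (sph_borel \<Otimes>\<^sub>M sph_borel) (\<lambda>N. (?T N, N))"
  have plan: "\<gamma> \<in> Plans \<mu> sph_sigma"
    unfolding Plans_def
  proof (intro CollectI conjI ballI)
    fix U :: "'a set" assume U: "U \<in> sets sph_borel"
    have Sph: "Sph \<in> sets (sph_borel :: 'a measure)" using sets.top[of sph_borel] by simp
    have "emeasure \<gamma> (U \<times> Sph) = emeasure sph_sigma (?T -` U \<inter> space sph_sigma)"
      unfolding \<gamma>_def by (subst emeasure_distr[OF P]) (use U Sph in \<open>auto intro!: arg_cong[where f = "emeasure _"]\<close>)
    then show "emeasure \<gamma> (U \<times> Sph) = emeasure \<mu> U"
      using emeasure_distr[OF T U] by (simp add: distr)
    show "emeasure \<gamma> (Sph \<times> U) = emeasure sph_sigma U"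
      unfolding \<gamma>_def using sets.sets_into_space[OF U] contact_in_Sph[OF \<rho>]
      by (subst emeasure_distr[OF P]) (use U Sph in \<open>auto intro!: arg_cong[where f = "emeasure _"]\<close>)
  qed (simp add: \<gamma>_def)
  define g where "g N = ln (\<rho> (?T N)) - ln (support_fun \<rho> N)" for N
  have AE: "AE N in sph_sigma. neg_cost (?T N, N) = ennreal (g N) \<and> 0 \<le> g N"
    using AE_sph_sigma_unique[OF radial_graph_compact[OF \<rho>]] AE_space
  proof eventually_elim
    case (elim N)
    then have N: "N \<in> Sph" by simp
    have pos: "0 < \<rho> (?T N)" using \<rho> contact_in_Sph[OF \<rho>] by (auto simp: radial_def)
    have eq: "\<rho> (?T N) * inner (?T N) N = support_fun \<rho> N"
      using contact_attains[OF \<rho>] elim by blast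
    with support_fun_pos[OF \<rho> N] pos have inner: "0 < inner (?T N) N"
      by (metis zero_less_mult_pos)
    have "g N = - ln (inner (?T N) N)"
      using pos inner by (simp add: g_def ln_mult_pos flip: eq)
    \<comment> \<open>This bound makes \<open>g N\<close> nonnegative, so
      \<open>ennreal (g N)\<close> does not truncate.\<close>
    moreover have "inner (?T N) N \<le> 1"
      using norm_cauchy_schwarz[of "?T N" N] N contact_in_Sph[OF \<rho>, of N] by simp
    ultimately show ?case using inner by (simp add: neg_cost_def)
  qed
  have meas: "(\<lambda>x. ln (\<rho> x)) \<in> borel_measurable sph_borel"
    using borel_measurable_continuous_on_restrict[OF continuous_on_ln_radial[OF \<rho>]]
    by (simp add: sph_borel_def)
  have int1: "integrable sph_sigma (\<lambda>N. ln (\<rho> (?T N)))"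
    using integrable_continuous_on_Sph[OF \<mu> continuous_on_ln_radial[OF \<rho>]]
    by (simp add: integrable_distr_eq[OF T meas] flip: distr)
  have int2: "integrable sph_sigma (\<lambda>N. ln (support_fun \<rho> N))"
    by (rule integrable_sph_sigma[OF continuous_on_ln_support_fun[OF \<rho>]])
  have "(\<integral>N. g N \<partial>sph_sigma) = (\<integral>x. ln (\<rho> x) \<partial>distr sph_sigma sph_borel ?T) - (\<integral>N. ln (support_fun \<rho> N) \<partial>sph_sigma)"
    unfolding g_def using int1 int2 by (simp add: integral_distr[OF T meas])
  then have Q: "(\<integral>N. g N \<partial>sph_sigma) = - Qfun \<mu> (support_fun \<rho>) \<rho>"
    by (simp add: distr Qfun_def)
  have g: "integrable sph_sigma g"
    unfolding g_def using int1 int2 by (rule Bochner_Integration.integrable_diff)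
  have "neg_cost \<in> borel_measurable (borel \<Otimes>\<^sub>M borel :: ('a \<times> 'a) measure)"
    unfolding neg_cost_def by measurable
  moreover have "(\<lambda>p. p) \<in> (sph_borel \<Otimes>\<^sub>M sph_borel) \<rightarrow>\<^sub>M (borel \<Otimes>\<^sub>M borel :: ('a \<times> 'a) measure)"
    using measurable_Pair[OF measurable_compose[OF measurable_fst measurable_ident_sph_borel]
        measurable_compose[OF measurable_snd measurable_ident_sph_borel]] by simp
  ultimately have nc: "neg_cost \<in> borel_measurable (sph_borel \<Otimes>\<^sub>M sph_borel :: ('a \<times> 'a) measure)"
    using measurable_compose by blast
  have "(\<integral>\<^sup>+p. neg_cost p \<partial>\<gamma>) = (\<integral>\<^sup>+N. neg_cost (?T N, N) \<partial>sph_sigma)"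
    unfolding \<gamma>_def using nc by (intro nn_integral_distr[OF P]) simp
  also have "\<dots> = (\<integral>\<^sup>+N. ennreal (g N) \<partial>sph_sigma)"
    using AE by (intro nn_integral_cong_AE) auto
  also have "\<dots> = ennreal (\<integral>N. g N \<partial>sph_sigma)"
    using AE by (intro nn_integral_eq_integral g) auto
  finally have "Cost \<gamma> = - enn2ereal (ennreal (\<integral>N. g N \<partial>sph_sigma))" by (simp add: Cost_def)
  also have "\<dots> = - ereal (\<integral>N. g N \<partial>sph_sigma)"
    using AE by (subst enn2ereal_ennreal) (auto intro!: integral_nonneg_AE)
  finally show ?thesis using plan Q by auto
qed

theorem theorem11:
  fixes \<mu> :: "'a::euclidean_space measure"
    and h\<rho> :: "('a \<Rightarrow> real) \<times> ('a \<Rightarrow> real)"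
  assumes dim: "DIM('a) \<ge> 2"
    and mu_sets: "sets \<mu> = sets sph_borel"
    and mu_total: "emeasure \<mu> Sph = emeasure sph_sigma Sph"
    and aleksandrov: "\<And>\<omega>. \<omega> \<in> sets sph_borel \<Longrightarrow> sph_convex \<omega> \<Longrightarrow> \<omega> \<noteq> {} \<Longrightarrow> \<omega> \<noteq> Sph \<Longrightarrow>
        emeasure \<mu> (Sph - \<omega>) > emeasure sph_sigma (polar_set \<omega>)"
    and adm: "admissible (fst h\<rho>) (snd h\<rho>)"
    and minimizer: "\<And>h \<rho>. admissible h \<rho> \<Longrightarrow> Qfun \<mu> (fst h\<rho>) (snd h\<rho>) \<le> Qfun \<mu> h \<rho>"
  shows "\<exists>\<gamma>\<in>Plans \<mu> sph_sigma.
           Cost \<gamma> = (SUP \<gamma>'\<in>Plans \<mu> sph_sigma. Cost \<gamma>') \<and>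
           ereal (Qfun \<mu> (fst h\<rho>) (snd h\<rho>)) = Cost \<gamma>"
proof -
  note \<rho> = admissible_radial(1)[OF adm]
  have "emeasure \<mu> (space \<mu>) \<noteq> \<infinity>"
    using finite_measure.emeasure_finite[OF finite_measure_sph_sigma] sets_eq_imp_space_eq[OF mu_sets]
    by (simp add: mu_total)
  then have \<mu>: "finite_measure \<mu>" by (rule finite_measureI)
  obtain \<gamma> where \<gamma>: "\<gamma> \<in> Plans \<mu> sph_sigma" "Cost \<gamma> = ereal (Qfun \<mu> (support_fun (snd h\<rho>)) (snd h\<rho>))"
    using contact_plan_attains[OF \<mu> mu_sets \<rho> distr_contact_eq[OF \<mu> mu_sets adm minimizer]] by blast
  \<comment> \<open>The given \<open>h\<close> need not be literally the support function;
    minimality forces equality of the two values.\<close>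
  have Q: "Qfun \<mu> (fst h\<rho>) (snd h\<rho>) = Qfun \<mu> (support_fun (snd h\<rho>)) (snd h\<rho>)"
    using minimizer[OF admissible_support_fun[OF \<rho>]] Qfun_support_fun_le[OF adm] by (rule antisym)
  have "(SUP \<gamma>'\<in>Plans \<mu> sph_sigma. Cost \<gamma>') = Cost \<gamma>"
  proof (rule SUP_eqI)
    show "Cost \<gamma>' \<le> Cost \<gamma>" if "\<gamma>' \<in> Plans \<mu> sph_sigma" for \<gamma>'
      using Cost_le_Qfun[OF \<mu> mu_sets adm that] \<gamma>(2) Q by simp
  qed (use \<gamma>(1) in blast)
  with \<gamma> Q show ?thesis by auto
qed

end
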